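(* Let $p\ge 3$ be a prime number and let $m=6p^2-6p+1$. Consider the matrix $A''\in\mathbb{C}^{m\times p}$ with entries $$A''_{j,k}=\exp\left(i2\pi\frac{j\,g(k)}{m}\right),\qquad j\in\{0,\dots,m-1\},\ k\in\{0,\dots,p-1\},$$ where $g(k)=2pk+(k^2)_p$. Then the matrix $M\in\mathbb{C}^{(m+p)\times p}$ obtained by stacking vertically $\frac{1}{(2m)^{1/4}}A''$ on top of $\frac{1}{2^{1/4}}I_p$, i.e. $$M=\begin{bmatrix}\frac{1}{(2m)^{1/4}}A''\\[2pt] \frac{1}{2^{1/4}}I_p\end{bmatrix},$$ provides an isometric embedding from $\ell_2^p(\mathbb{C})$ into $\ell_4^{m+p}(\mathbb{C})$, i.e., $$\|Mx\|_4=\|x\|_2\qquad\text{for all }x\in\mathbb{C}^p.$$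
   Context: For an integer $k$, $(k^2)_p$ denotes the integer $t\in\{0,\dots,p-1\}$ such that $k^2\equiv t \pmod p$. $I_p$ is the $p\times p$ identity matrix. $\|\cdot\|_q$ denotes the usual (unnormalized) $\ell_q$-norm, $\|y\|_q=(\sum_i|y_i|^q)^{1/q}$. $i$ in the exponential is the imaginary unit. *)

theory Defs
  imports
    Complex_Main
    "HOL-Computational_Algebra.Primes"
    "Jordan_Normal_Form.Matrix"
begin

definition lq_norm :: "real \<Rightarrow> complex vec \<Rightarrow> real" where
  "lq_norm q y = (\<Sum>i<dim_vec y. cmod (y $ i) powr q) powr (1 / q)"

(* The residue (k^2)_p in {0, ..., p - 1}, for an integer k. *)
definition sq_residue :: "nat \<Rightarrow> int \<Rightarrow> int" where
  "sq_residue p k = k\<^sup>2 mod int p"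

definition g :: "nat \<Rightarrow> int \<Rightarrow> int" where
  "g p k = 2 * int p * k + sq_residue p k"

end

theory Submission
  imports Defs
begin

text \<open>
  The frequencies \<open>g 0, \<dots>, g (p - 1)\<close> form a Sidon set modulo \<open>m\<close>: a congruence
  \<open>g a + g b \<equiv> g c + g d\<close> is an equality of integers because \<open>m\<close> is large, comparing quotients
  modulo \<open>2 p\<close> gives \<open>a + b = c + d\<close> and \<open>a\<^sup>2 + b\<^sup>2 \<equiv> c\<^sup>2 + d\<^sup>2\<close> modulo \<open>p\<close>, and these
  two relations determine the pair up to order. Expanding the fourth power and using orthogonality
  of the additive characters, only the diagonal terms survive, so the top block contributes
  \<open>m (2 (\<Sum>\<bar>x\<bar>\<^sup>2)\<^sup>2 - \<Sum>\<bar>x\<bar>\<^sup>4)\<close>; the identity block cancels the defect \<open>\<Sum>\<bar>x\<bar>\<^sup>4\<close>.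
\<close>

text \<open>The summands are the powers of \<open>w\<close>, an \<open>m\<close>-th root of unity
  that equals 1 exactly when \<open>m\<close> divides \<open>n\<close>; otherwise the geometric sum
  has numerator \<open>w ^ m - 1 = 0\<close>.\<close>

lemma sum_characters:
  fixes n :: int
  assumes "m > 0"
  shows "(\<Sum>j<m. cis (2 * pi * (real j * of_int n) / real m)) = (if int m dvd n then of_nat m else 0)"
proof -
  define w where "w = cis (2 * pi * of_int n / real m)"
  have pw: "cis (2 * pi * (real j * of_int n) / real m) = w ^ j" for j
    unfolding w_def by (simp add: DeMoivre mult_ac)
  show ?thesis
  proof (cases "int m dvd n")
    case True
    then obtain k where "n = int m * k" by auto
    then have "2 * pi * of_int n / real m = 2 * pi * of_int k" using assms by simp
    then have "w = 1" unfolding w_def by (simp only: cis_multiple_2pi Ints_of_int)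
    then show ?thesis using True by (simp add: pw)
  next
    case False
    have "w \<noteq> 1"
    proof
      assume "w = 1"
      then have "cos (2 * pi * of_int n / real m) = 1"
        by (simp add: w_def complex_eq_iff)
      then obtain k :: int where "2 * pi * of_int n / real m = of_int k * (2 * pi)"
        by (auto simp: cos_one_2pi_int)
      then have "(of_int n :: real) = of_int (int m * k)"
        using assms by (simp add: field_simps)
      then show False using False by (simp only: of_int_eq_iff) simp
    qed
    moreover have "w ^ m = cis (2 * pi * of_int n)"
      using assms by (simp add: w_def DeMoivre)
    then have "w ^ m = 1" using cis_multiple_2pi[of "of_int n"] by simp
    ultimately show ?thesis using False by (simp add: pw geometric_sum)
  qed
qed

text \<open>After summation over \<open>j\<close> only quadruples with
  \<open>{c, d} = {a, b}\<close> remain. Each of the two pairings contributes the squared sum of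
  squares, and the quadruples \<open>a = b = c = d\<close>, counted by both, account for the
  subtracted fourth powers.\<close>

lemma sum_cmod_power4_sidon:
  fixes x :: "nat \<Rightarrow> complex" and s :: "nat \<Rightarrow> int"
  assumes m: "m > 0"
    and sidon: "\<And>a b c d. \<lbrakk>a < p; b < p; c < p; d < p; int m dvd s a + s b - s c - s d\<rbrakk>
                  \<Longrightarrow> c = a \<and> d = b \<or> c = b \<and> d = a"
  shows "(\<Sum>j<m. cmod (\<Sum>k<p. x k * cis (2 * pi * (real j * of_int (s k)) / real m)) ^ 4)
         = real m * (2 * (\<Sum>k<p. cmod (x k) ^ 2)\<^sup>2 - (\<Sum>k<p. cmod (x k) ^ 4))"
proof -
  define e where "e j n = cis (2 * pi * (real j * of_int n) / real m)" for j :: nat and n :: int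
  define y where "y j = (\<Sum>k<p. x k * e j (s k))" for j
  have e_add: "e j (u + v) = e j u * e j v" for j u v
    by (simp add: e_def cis_mult add_divide_distrib ring_distribs)
  have e_cnj: "cnj (e j u) = e j (- u)" for j u
    by (simp add: e_def cis_cnj)
  have e4: "e j (sa + sb - sc - sd) = e j sa * e j sb * (cnj (e j sc) * cnj (e j sd))"
    for j sa sb sc sd
    by (simp add: e_cnj flip: e_add) (simp add: algebra_simps)
  define F where "F a b c d = x a * x b * (cnj (x c) * cnj (x d))" for a b c d
  \<comment> \<open>Two plain and two conjugated factors match the signs in
    \<open>s a + s b - s c - s d\<close>.\<close>
  have pow4: "complex_of_real (cmod z ^ 4) = (z * z) * (cnj z * cnj z)" for z
  proof -
    have "complex_of_real (cmod z ^ 4) = (complex_of_real ((cmod z)\<^sup>2))\<^sup>2"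
      by (simp flip: power_mult)
    then show ?thesis
      by (simp only: complex_norm_square) (simp add: power2_eq_square mult_ac)
  qed
  have expand: "complex_of_real (cmod (y j) ^ 4)
        = (\<Sum>a<p. \<Sum>b<p. \<Sum>c<p. \<Sum>d<p. F a b c d * e j (s a + s b - s c - s d))" for j
  proof -
    let ?u = "\<lambda>k. x k * e j (s k)"
    have "complex_of_real (cmod (y j) ^ 4)
        = (\<Sum>a<p. \<Sum>b<p. ?u a * ?u b) * (\<Sum>c<p. \<Sum>d<p. cnj (?u c) * cnj (?u d))"
      by (simp only: pow4 y_def cnj_sum sum_product)
    also have "\<dots> = (\<Sum>a<p. \<Sum>b<p. \<Sum>c<p. \<Sum>d<p. ?u a * ?u b * (cnj (?u c) * cnj (?u d)))"
      by (simp only: sum_distrib_right) (simp only: sum_distrib_left)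
    finally show ?thesis by (simp add: F_def e4 mult_ac)
  qed
  have sum_if: "(\<Sum>d<p. if P then f d else 0) = (if P then \<Sum>d<p. f d else 0)"
    for P and f :: "nat \<Rightarrow> complex"
    by simp
  \<comment> \<open>Inclusion-exclusion over the two pairings, whose overlap is
    \<open>a = b = c = d\<close>. Each nested \<open>if\<close> tests a single index, so the inner
    sums collapse one at a time, with \<open>sum_if\<close> pulling out conditions free of the
    summation variable.\<close>
  have diag: "F a b c d * (if int m dvd s a + s b - s c - s d then of_nat m else 0)
      = of_nat m * ((if c = a then if d = b then F a b a b else 0 else 0)
         + (if c = b then if d = a then F a b b a else 0 else 0)
         - (if c = a then if d = a then if b = a then F a a a a else 0 else 0 else 0))"
    if "a < p" "b < p" "c < p" "d < p" for a b c d
    using sidon[OF that] by (auto simp: algebra_simps)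
  have "complex_of_real (\<Sum>j<m. cmod (y j) ^ 4)
      = (\<Sum>j<m. \<Sum>a<p. \<Sum>b<p. \<Sum>c<p. \<Sum>d<p. F a b c d * e j (s a + s b - s c - s d))"
    by (simp only: of_real_sum expand)
  also have "\<dots> = (\<Sum>a<p. \<Sum>b<p. \<Sum>c<p. \<Sum>d<p. \<Sum>j<m. F a b c d * e j (s a + s b - s c - s d))"
    \<comment> \<open>Fixing both index sets orients the swap: the sum over \<open>j\<close> moves
      inwards past the other four and the rewriting stops.\<close>
    by (simp only: sum.swap[where A = "{..<m}" and B = "{..<p}"])
  also have "\<dots> = (\<Sum>a<p. \<Sum>b<p. \<Sum>c<p. \<Sum>d<p.
      F a b c d * (if int m dvd s a + s b - s c - s d then of_nat m else 0))"
    unfolding e_def by (simp only: sum_distrib_left[symmetric] sum_characters[OF m])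
  also have "\<dots> = (\<Sum>a<p. \<Sum>b<p. \<Sum>c<p. \<Sum>d<p.
      of_nat m * ((if c = a then if d = b then F a b a b else 0 else 0)
         + (if c = b then if d = a then F a b b a else 0 else 0)
         - (if c = a then if d = a then if b = a then F a a a a else 0 else 0 else 0)))"
    by (intro sum.cong refl diag) auto
  also have "\<dots> = of_nat m * (\<Sum>a<p. \<Sum>b<p. F a b a b + F a b b a - (if b = a then F a a a a else 0))"
    unfolding sum_distrib_left[symmetric]
    by (intro arg_cong[where f = "(*) _"] sum.cong refl)
      (simp add: sum.distrib sum_subtractf sum_if)
  also have "\<dots> = of_nat m * (2 * (\<Sum>a<p. \<Sum>b<p. F a b a b) - (\<Sum>a<p. F a a a a))"
  proof -
    have "(\<Sum>a<p. \<Sum>b<p. F a b b a) = (\<Sum>a<p. \<Sum>b<p. F a b a b)" by (simp add: F_def mult_ac)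
    then show ?thesis by (simp only: sum.distrib sum_subtractf mult_2) simp
  qed
  also have "(\<Sum>a<p. F a a a a) = complex_of_real (\<Sum>a<p. cmod (x a) ^ 4)"
    by (simp only: of_real_sum pow4 F_def)
  also have "(\<Sum>a<p. \<Sum>b<p. F a b a b) = complex_of_real ((\<Sum>a<p. cmod (x a) ^ 2)\<^sup>2)"
    by (simp only: power2_eq_square[of "sum _ _"] of_real_mult of_real_sum complex_norm_square
        sum_product F_def mult_ac)
  finally have "complex_of_real (\<Sum>j<m. cmod (y j) ^ 4) = complex_of_real
      (real m * (2 * (\<Sum>k<p. cmod (x k) ^ 2)\<^sup>2 - (\<Sum>k<p. cmod (x k) ^ 4)))"
    by simp
  then show ?thesis unfolding y_def e_def of_real_eq_iff .
qed

text \<open>\<open>g\<close> packs an index and its square modulo \<open>p\<close> into one integer,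
  as quotient and remainder modulo \<open>2 * p\<close>, so that adding two values adds both data
  independently.\<close>

lemma g_sidon:
  fixes a b c d :: nat
  assumes p: "prime p" "p \<ge> 3" and lt: "a < p" "b < p" "c < p" "d < p"
    and dv: "6 * (int p)\<^sup>2 - 6 * int p + 1 dvd g p a + g p b - g p c - g p d"
  shows "c = a \<and> d = b \<or> c = b \<and> d = a"
proof -
  define r where "r k = sq_residue p (int k)" for k
  have r: "0 \<le> r k" "r k \<le> int p - 1" for k
    using p by (simp_all add: r_def sq_residue_def)
  have bnd: "0 \<le> g p k \<and> g p k \<le> 2 * int p * (int p - 1) + (int p - 1)" if "k < p" for k :: nat
  proof -
    have "2 * int p * int k \<le> 2 * int p * (int p - 1)" using that by (intro mult_left_mono) auto
    then show ?thesis using r[of k] unfolding g_def r_def[symmetric] by (auto intro: add_mono)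
  qed
  let ?n = "g p a + g p b - g p c - g p d"
  \<comment> \<open>The right side equals \<open>2 * (p - 1)^2\<close>, which is one less than the
    gap between the two sides of the next inequality. The left side of that inequality is twice the
    maximal value of \<open>g\<close>, a bound for the absolute value of \<open>?n\<close>.\<close>
  have "0 \<le> (int p - 3) * (2 * int p + 2) + 8" using p by simp
  then have "2 * (2 * int p * (int p - 1) + (int p - 1)) < 6 * (int p)\<^sup>2 - 6 * int p + 1"
    by (simp add: power2_eq_square algebra_simps)
  moreover have "\<bar>t + u - v - w\<bar> \<le> 2 * L"
    if "0 \<le> t \<and> t \<le> L" "0 \<le> u \<and> u \<le> L" "0 \<le> v \<and> v \<le> L" "0 \<le> w \<and> w \<le> L"
    for t u v w L :: int
    using that by auto
  note this[OF bnd[OF lt(1)] bnd[OF lt(2)] bnd[OF lt(3)] bnd[OF lt(4)]]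
  ultimately have "\<bar>?n\<bar> < 6 * (int p)\<^sup>2 - 6 * int p + 1"
    by (rule le_less_trans[rotated])
  then have "?n = 0" using dvd_imp_le_int[OF _ dv] by (meson abs_ge_self not_le order_trans)
  then have eq: "2 * int p * (int a + int b) + (r a + r b) = 2 * int p * (int c + int d) + (r c + r d)"
    by (simp add: g_def r_def algebra_simps)
  \<comment> \<open>No carry occurs: two residues add up to at most
    \<open>2 * p - 2\<close>.\<close>
  have "(2 * int p * (int a + int b) + (r a + r b)) div (2 * int p) = int a + int b"
    "(2 * int p * (int c + int d) + (r c + r d)) div (2 * int p) = int c + int d"
    using p r[of a] r[of b] r[of c] r[of d] by auto
  with eq have sum_eq: "int a + int b = int c + int d" by simp
  then have "r a + r b = r c + r d" using eq by simp
  then have "((int a)\<^sup>2 + (int b)\<^sup>2) mod int p = ((int c)\<^sup>2 + (int d)\<^sup>2) mod int p"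
    unfolding r_def sq_residue_def by (metis mod_add_eq)
  then have "int p dvd ((int a)\<^sup>2 + (int b)\<^sup>2) - ((int c)\<^sup>2 + (int d)\<^sup>2)"
    by (simp add: mod_eq_dvd_iff)
  \<comment> \<open>Eliminating \<open>b\<close> leaves a quadratic in \<open>a\<close> with roots
    \<open>c\<close> and \<open>d\<close>. The prime \<open>p\<close> is odd, so it divides one of
    the linear factors, and that factor vanishes because it is smaller than \<open>p\<close> in
    absolute value.\<close>
  also have "((int a)\<^sup>2 + (int b)\<^sup>2) - ((int c)\<^sup>2 + (int d)\<^sup>2) = 2 * (int a - int c) * (int a - int d)"
  proof -
    have b: "int b = int c + int d - int a" using sum_eq by simp
    show ?thesis unfolding b by (simp add: power2_eq_square algebra_simps)
  qed
  finally have "int p dvd 2 * (int a - int c) * (int a - int d)" .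
  moreover have "prime (int p)" using p by simp
  ultimately have "int p dvd 2 \<or> int p dvd int a - int c \<or> int p dvd int a - int d"
    by (simp only: prime_dvd_mult_iff disj_assoc)
  moreover have "\<not> int p dvd 2" using p by (auto dest: zdvd_imp_le)
  moreover have "u = v" if "int p dvd int u - int v" "u < p" "v < p" for u v
    using that dvd_imp_le_int[of "int u - int v" "int p"] by fastforce
  ultimately have "a = c \<or> a = d" using lt by blast
  then show ?thesis using sum_eq by auto
qed

theorem theorem2:
  fixes p m :: nat and A M :: "complex mat"
  assumes "prime p" and "p \<ge> 3"
    and "m = 6 * p\<^sup>2 - 6 * p + 1"
    and "A = mat m p (\<lambda>(j, k).
           exp (\<i> * 2 * complex_of_real pi * (of_nat j * of_int (g p (int k))) / of_nat m))"
    and "M = complex_of_real (1 / (2 * real m) powr (1 / 4)) \<cdot>\<^sub>m A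
             @\<^sub>r complex_of_real (1 / 2 powr (1 / 4)) \<cdot>\<^sub>m 1\<^sub>m p"
  shows "M \<in> carrier_mat (m + p) p \<and>
         (\<forall>x \<in> carrier_vec p. lq_norm 4 (M *\<^sub>v x) = lq_norm 2 x)"
proof (intro conjI ballI)
  let ?s = "1 / (2 * real m) powr (1 / 4)" and ?t = "1 / 2 powr (1 / 4) :: real"
  let ?B = "complex_of_real ?s \<cdot>\<^sub>m A" and ?C = "complex_of_real ?t \<cdot>\<^sub>m 1\<^sub>m p"
  have m: "m > 0" using assms(3) by simp
  \<comment> \<open>The natural subtraction in \<open>m\<close> does not truncate, since
    \<open>p \<le> p * p\<close>.\<close>
  have int_m: "int m = 6 * (int p)\<^sup>2 - 6 * int p + 1"
    using assms(3) by (simp add: of_nat_diff power2_eq_square)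
  have A: "A \<in> carrier_mat m p" using assms(4) by simp
  have B: "?B \<in> carrier_mat m p" and C: "?C \<in> carrier_mat p p" using A by auto
  show M: "M \<in> carrier_mat (m + p) p"
    unfolding assms(5) using carrier_append_rows[OF B C] .
  fix x :: "complex vec"
  assume x: "x \<in> carrier_vec p"
  define S where "S = (\<Sum>k<p. (cmod (x $ k))\<^sup>2)"
  define y where "y j = (\<Sum>k<p. x $ k * cis (2 * pi * (real j * of_int (g p (int k))) / real m))" for j
  have Mx: "M *\<^sub>v x = (?B *\<^sub>v x) @\<^sub>v (?C *\<^sub>v x)"
    unfolding assms(5) by (rule mat_mult_append[OF B C x])
  have top: "(M *\<^sub>v x) $ j = complex_of_real ?s * y j" if "j < m" for j
  proof -
    have "(M *\<^sub>v x) $ j = (?B *\<^sub>v x) $ j"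
      unfolding Mx using that A by simp
    also have "\<dots> = (\<Sum>k<p. complex_of_real ?s * A $$ (j, k) * x $ k)"
      using that A x by (simp add: scalar_prod_def lessThan_atLeast0)
    also have "\<dots> = complex_of_real ?s * y j"
      unfolding y_def sum_distrib_left
      using that by (intro sum.cong) (auto simp: assms(4) cis_conv_exp mult_ac)
    finally show ?thesis .
  qed
  have bottom: "(M *\<^sub>v x) $ (m + k) = complex_of_real ?t * x $ k" if "k < p" for k
  proof -
    have "(M *\<^sub>v x) $ (m + k) = (?C *\<^sub>v x) $ k"
      unfolding Mx using that A by simp
    also have "\<dots> = complex_of_real ?t * x $ k"
      using that x by simp
    finally show ?thesis .
  qed
  \<comment> \<open>With these weights the top block contributes \<open>S^2\<close> minus half the
    sum of fourth powers, and the bottom block adds exactly that half back.\<close>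
  have scale: "?s ^ 4 = 1 / (2 * real m)" "?t ^ 4 = 1 / 2"
    using m by (simp_all add: power_divide powr_powr flip: powr_realpow)
  have split: "(\<Sum>i<m + q. f i) = (\<Sum>i<m. f i) + (\<Sum>k<q. f (m + k))" for q and f :: "nat \<Rightarrow> real"
    by (induction q) simp_all
  have "(\<Sum>i<m + p. cmod ((M *\<^sub>v x) $ i) ^ 4)
      = (\<Sum>j<m. ?s ^ 4 * cmod (y j) ^ 4) + (\<Sum>k<p. ?t ^ 4 * cmod (x $ k) ^ 4)"
    unfolding split
    by (intro arg_cong2[where f = "(+)"] sum.cong refl)
      (simp_all only: lessThan_iff top bottom norm_mult power_mult_distrib norm_of_real power_even_abs_numeral
        even_numeral)
  also have "\<dots> = (\<Sum>j<m. cmod (y j) ^ 4) / (2 * real m) + (\<Sum>k<p. cmod (x $ k) ^ 4) / 2"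
    by (simp only: scale sum_distrib_left[symmetric]) simp
  also have "(\<Sum>j<m. cmod (y j) ^ 4) = real m * (2 * S\<^sup>2 - (\<Sum>k<p. cmod (x $ k) ^ 4))"
    unfolding y_def S_def
    using g_sidon[OF assms(1,2)] by (intro sum_cmod_power4_sidon[OF m]) (auto simp: int_m)
  finally have "(\<Sum>i<m + p. cmod ((M *\<^sub>v x) $ i) ^ 4) = S\<^sup>2"
    using m by (simp add: field_simps)
  moreover have "dim_vec (M *\<^sub>v x) = m + p" using M by simp
  ultimately have "lq_norm 4 (M *\<^sub>v x) = S\<^sup>2 powr (1 / 4)"
    by (simp add: lq_norm_def)
  \<comment> \<open>Passing from the square to \<open>powr\<close> uses that \<open>S\<close> is
    nonnegative; as \<open>0 powr 2 = 0\<close>, the zero vector is covered too.\<close>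
  also have "\<dots> = (S powr 2) powr (1 / 4)"
    by (simp add: S_def sum_nonneg)
  also have "\<dots> = S powr (1 / 2)"
    by (simp add: powr_powr)
  also have "\<dots> = lq_norm 2 x"
    using x by (simp add: lq_norm_def S_def)
  finally show "lq_norm 4 (M *\<^sub>v x) = lq_norm 2 x" .
qed

end
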